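(* Every toupie algebra is quasi-hereditary.
   Context: $\mathbb{k}$ is a field of characteristic zero. A finite quiver $Q$ is toupie if it has a unique source and a unique sink and every other vertex is the source of exactly one arrow and the target of exactly one arrow. A toupie algebra is an algebra $A=\mathbb{k}Q/I$ with $Q$ a toupie quiver and $I\subseteq\mathbb{k}Q$ an admissible ideal.
   Formalization: The quiver is also assumed connected; otherwise a vertex together with a disjoint loop x and I = (x²) meets the stated definition, but its algebra k × k[x]/(x²) is not quasi-hereditary. *)

theory Defs
  imports
    "HOL-Algebra.Algebra"
    "HOL-Algebra.Algebraic_Closure_Type"
    "Graph_Theory.Graph_Theory"
begin

section \<open>Finite-dimensional algebras over a field\<close>

text \<open>
  The library locale \<open>algebra\<close> is about commutative algebras; the following is the notion of a
  unital associative, not necessarily commutative algebra. Scalars form a whole type of class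
  \<open>field\<close>, viewed as a ring record by \<^const>\<open>ring_of_type_algebra\<close>.
\<close>

locale k_algebra =
  ring A + module "ring_of_type_algebra :: 'k ring" A
  for A :: "('k::field, 'a, 'm) module_scheme" (structure) +
  assumes smult_mult_left:
      "\<lbrakk>x \<in> carrier A; y \<in> carrier A\<rbrakk> \<Longrightarrow> (c \<odot> x) \<otimes> y = c \<odot> (x \<otimes> y)"
    and smult_mult_right:
      "\<lbrakk>x \<in> carrier A; y \<in> carrier A\<rbrakk> \<Longrightarrow> x \<otimes> (c \<odot> y) = c \<odot> (x \<otimes> y)"

locale fin_dim_algebra = k_algebra +
  assumes finite_spanning_set:
    "\<exists>B. finite B \<and> B \<subseteq> carrier A \<and>
       (\<forall>x\<in>carrier A. \<exists>c. x = (\<Oplus>b\<in>B. c b \<odot> b))"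

definition quotient_algebra ::
    "('k, 'a, 'm) module_scheme \<Rightarrow> 'a set \<Rightarrow> ('k, 'a set) module" where
  "quotient_algebra A I =
     \<lparr>carrier = carrier (A Quot I), monoid.mult = monoid.mult (A Quot I), one = one (A Quot I),
      ring.zero = ring.zero (A Quot I), ring.add = ring.add (A Quot I),
      module.smult = (\<lambda>c U. \<Union>x\<in>U. I +>\<^bsub>A\<^esub> (c \<odot>\<^bsub>A\<^esub> x))\<rparr>"


section \<open>Quivers, path algebras and admissible ideals\<close>

text \<open>
  A finite quiver is a \<^locale>\<open>fin_digraph\<close>, which allows loops and parallel arrows.
  A path is a pair of its starting vertex and its list of arrows, in the order in which they
  are traversed; the pair with the empty list is the stationary path at that vertex.
\<close>

definition paths :: "('v, 'e) pre_digraph \<Rightarrow> ('v \<times> 'e list) set" where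
  "paths Q = {(u, p). \<exists>v. pre_digraph.awalk Q u p v}"

text \<open>
  Elements of the path algebra are finitely supported coefficient functions on the paths.
  The product of two paths is their concatenation (first factor traversed first) if they are
  composable and zero otherwise. In the bilinear extension, the coefficient at a path is the
  sum over all its factorizations into an initial and a final segment.
\<close>

definition path_algebra ::
    "('v, 'e) pre_digraph \<Rightarrow> ('k::field, 'v \<times> 'e list \<Rightarrow> 'k) module" where
  "path_algebra Q =
     \<lparr>carrier = {f. finite {w. f w \<noteq> 0} \<and> {w. f w \<noteq> 0} \<subseteq> paths Q},
      monoid.mult = (\<lambda>f g (u, p). \<Sum>i\<le>length p.
        f (u, take i p) * g (pre_digraph.awlast Q u (take i p), drop i p)),
      one = (\<lambda>(u, p). if u \<in> verts Q \<and> p = [] then 1 else 0),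
      ring.zero = (\<lambda>w. 0),
      ring.add = (\<lambda>f g w. f w + g w),
      module.smult = (\<lambda>c f w. c * f w)\<rparr>"

definition path_elem :: "'v \<times> 'e list \<Rightarrow> ('v \<times> 'e list \<Rightarrow> 'k::field)" where
  "path_elem w = (\<lambda>w'. if w' = w then 1 else 0)"

definition arrow_ideal :: "('v, 'e) pre_digraph \<Rightarrow> ('v \<times> 'e list \<Rightarrow> 'k::field) set" where
  "arrow_ideal Q = Idl\<^bsub>path_algebra Q\<^esub> ((\<lambda>a. path_elem (tail Q a, [a])) ` arcs Q)"

primrec ideal_power :: "('a, 'm) ring_scheme \<Rightarrow> 'a set \<Rightarrow> nat \<Rightarrow> 'a set" where
  "ideal_power R I 0 = carrier R"
| "ideal_power R I (Suc n) = ideal_prod R (ideal_power R I n) I"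

definition admissible_ideal ::
    "('v, 'e) pre_digraph \<Rightarrow> ('v \<times> 'e list \<Rightarrow> 'k::field) set \<Rightarrow> bool" where
  "admissible_ideal Q I \<longleftrightarrow>
     ideal I (path_algebra Q) \<and>
     (\<exists>m\<ge>2. ideal_power (path_algebra Q) (arrow_ideal Q) m \<subseteq> I) \<and>
     I \<subseteq> ideal_power (path_algebra Q) (arrow_ideal Q) 2"


section \<open>Toupie quivers\<close>

definition is_source :: "('v, 'e) pre_digraph \<Rightarrow> 'v \<Rightarrow> bool" where
  "is_source Q v \<longleftrightarrow> v \<in> verts Q \<and> in_arcs Q v = {}"

definition is_sink :: "('v, 'e) pre_digraph \<Rightarrow> 'v \<Rightarrow> bool" where
  "is_sink Q v \<longleftrightarrow> v \<in> verts Q \<and> out_arcs Q v = {}"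

text \<open>
  Connectedness is part of the usual conventions on quivers. It is needed here: without it,
  a disjoint oriented cycle would satisfy the remaining conditions, since each of its vertices
  is the source of exactly one arrow and the target of exactly one arrow.
\<close>

definition toupie_quiver :: "('v, 'e) pre_digraph \<Rightarrow> bool" where
  "toupie_quiver Q \<longleftrightarrow>
     fin_digraph Q \<and> Digraph_Component.connected Q \<and>
     (\<exists>!v. is_source Q v) \<and> (\<exists>!v. is_sink Q v) \<and>
     (\<forall>v\<in>verts Q. \<not> is_source Q v \<longrightarrow> \<not> is_sink Q v \<longrightarrow>
        out_degree Q v = 1 \<and> in_degree Q v = 1)"


section \<open>Right modules and the Jacobson radical\<close>

text \<open>
  The library locale \<open>module\<close> requires commutative scalars. For a right module \<open>M\<close>, the term
  \<open>a \<odot>\<^bsub>M\<^esub> x\<close> stands for the right action of the scalar \<open>a\<close> on \<open>x\<close>, which is why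
  \<open>smult_assoc\<close> reverses the factors. The ring structure fields \<open>mult\<close> and \<open>one\<close> of the
  record are irrelevant for modules.
\<close>

locale right_module = R?: ring R + M?: abelian_group M
  for R :: "('a, 'c) ring_scheme" and M :: "('a, 'b, 'm) module_scheme" (structure) +
  assumes smult_closed: "\<lbrakk>a \<in> carrier R; x \<in> carrier M\<rbrakk> \<Longrightarrow> a \<odot> x \<in> carrier M"
    and smult_l_distr: "\<lbrakk>a \<in> carrier R; b \<in> carrier R; x \<in> carrier M\<rbrakk> \<Longrightarrow>
          (a \<oplus>\<^bsub>R\<^esub> b) \<odot> x = a \<odot> x \<oplus> b \<odot> x"
    and smult_r_distr: "\<lbrakk>a \<in> carrier R; x \<in> carrier M; y \<in> carrier M\<rbrakk> \<Longrightarrow>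
          a \<odot> (x \<oplus> y) = a \<odot> x \<oplus> a \<odot> y"
    and smult_assoc: "\<lbrakk>a \<in> carrier R; b \<in> carrier R; x \<in> carrier M\<rbrakk> \<Longrightarrow>
          (a \<otimes>\<^bsub>R\<^esub> b) \<odot> x = b \<odot> (a \<odot> x)"
    and smult_one: "x \<in> carrier M \<Longrightarrow> \<one>\<^bsub>R\<^esub> \<odot> x = x"

definition right_module_hom ::
    "('a, 'c) ring_scheme \<Rightarrow> ('a, 'b, 'm) module_scheme \<Rightarrow> ('a, 'd, 'n) module_scheme
      \<Rightarrow> ('b \<Rightarrow> 'd) set" where
  "right_module_hom R M N =
     {h. h \<in> carrier M \<rightarrow> carrier N \<and>
         (\<forall>x\<in>carrier M. \<forall>y\<in>carrier M. h (x \<oplus>\<^bsub>M\<^esub> y) = h x \<oplus>\<^bsub>N\<^esub> h y) \<and>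
         (\<forall>a\<in>carrier R. \<forall>x\<in>carrier M. h (a \<odot>\<^bsub>M\<^esub> x) = a \<odot>\<^bsub>N\<^esub> h x)}"

definition free_right_module ::
    "('a, 'c) ring_scheme \<Rightarrow> 'x set \<Rightarrow> ('a, 'x \<Rightarrow> 'a) module" where
  "free_right_module R B =
     \<lparr>carrier = {f. (\<forall>x. f x \<in> carrier R) \<and> finite {x. f x \<noteq> \<zero>\<^bsub>R\<^esub>} \<and> {x. f x \<noteq> \<zero>\<^bsub>R\<^esub>} \<subseteq> B},
      monoid.mult = undefined, one = undefined,
      ring.zero = (\<lambda>x. \<zero>\<^bsub>R\<^esub>),
      ring.add = (\<lambda>f g x. f x \<oplus>\<^bsub>R\<^esub> g x),
      module.smult = (\<lambda>a f x. f x \<otimes>\<^bsub>R\<^esub> a)\<rparr>"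

text \<open>
  Projective means isomorphic to a direct summand of a free module. Taking the basis inside the
  element type of the module is no restriction: every module is a quotient of the free module
  on its own carrier, and the quotient map splits if the module is projective.
\<close>

definition projective_right_module ::
    "('a, 'c) ring_scheme \<Rightarrow> ('a, 'b, 'm) module_scheme \<Rightarrow> bool" where
  "projective_right_module R P \<longleftrightarrow>
     right_module R P \<and>
     (\<exists>(B :: 'b set).
        \<exists>\<iota> \<in> right_module_hom R P (free_right_module R B).
        \<exists>\<pi> \<in> right_module_hom R (free_right_module R B) P.
          \<forall>x\<in>carrier P. \<pi> (\<iota> x) = x)"

locale right_ideal = additive_subgroup J R + ring R for J and R (structure) +
  assumes r_closed: "\<lbrakk>x \<in> J; a \<in> carrier R\<rbrakk> \<Longrightarrow> x \<otimes> a \<in> J"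

definition right_ideal_module :: "('a, 'c) ring_scheme \<Rightarrow> 'a set \<Rightarrow> ('a, 'a) module" where
  "right_ideal_module R J =
     \<lparr>carrier = J, monoid.mult = undefined, one = undefined,
      ring.zero = \<zero>\<^bsub>R\<^esub>, ring.add = ring.add R, module.smult = (\<lambda>a x. x \<otimes>\<^bsub>R\<^esub> a)\<rparr>"

definition maximal_right_ideal :: "'a set \<Rightarrow> ('a, 'c) ring_scheme \<Rightarrow> bool" where
  "maximal_right_ideal M R \<longleftrightarrow>
     right_ideal M R \<and> M \<noteq> carrier R \<and>
     (\<forall>J. right_ideal J R \<longrightarrow> M \<subseteq> J \<longrightarrow> J = M \<or> J = carrier R)"

definition jacobson_radical :: "('a, 'c) ring_scheme \<Rightarrow> 'a set" where
  "jacobson_radical R = {x \<in> carrier R. \<forall>M. maximal_right_ideal M R \<longrightarrow> x \<in> M}"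


section \<open>Quasi-hereditary algebras\<close>

text \<open>
  These are the definitions of Cline, Parshall and Scott: an ideal \<open>J\<close> is a heredity ideal if
  \<open>J\<^sup>2 = J\<close>, \<open>J rad(R) J = 0\<close> and \<open>J\<close> is projective as a right module, and a finite-dimensional
  algebra \<open>A\<close> is quasi-hereditary if there are ideals
  \<open>0 = J\<^sub>0 \<subset> J\<^sub>1 \<subset> \<dots> \<subset> J\<^sub>n = A\<close> such that each
  \<open>J\<^sub>i\<^sub>+\<^sub>1 / J\<^sub>i\<close>, here the set of cosets of the elements of \<open>J\<^sub>i\<^sub>+\<^sub>1\<close>,
  is a heredity ideal of \<open>A / J\<^sub>i\<close>.
\<close>

definition heredity_ideal :: "'a set \<Rightarrow> ('a, 'c) ring_scheme \<Rightarrow> bool" where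
  "heredity_ideal J R \<longleftrightarrow>
     ideal J R \<and>
     ideal_prod R J J = J \<and>
     ideal_prod R (ideal_prod R J (jacobson_radical R)) J = {\<zero>\<^bsub>R\<^esub>} \<and>
     projective_right_module R (right_ideal_module R J)"

definition quasi_hereditary :: "('k::field, 'a, 'm) module_scheme \<Rightarrow> bool" where
  "quasi_hereditary A \<longleftrightarrow>
     fin_dim_algebra A \<and>
     (\<exists>(n::nat) J. J 0 = {\<zero>\<^bsub>A\<^esub>} \<and> J n = carrier A \<and>
        (\<forall>i\<le>n. ideal (J i) A) \<and>
        (\<forall>i<n. J i \<subset> J (Suc i) \<and>
           heredity_ideal ((\<lambda>x. J i +>\<^bsub>A\<^esub> x) ` J (Suc i)) (A Quot J i)))"

end

theory Submission
  imports Defs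
begin

text \<open>
  A toupie quiver has no oriented cycle: every vertex of a cycle would be an inner vertex, so the
  cycle would be a whole connected component. Hence its vertices can be listed as
  \<open>v\<^sub>1, \<dots>, v\<^sub>n\<close> with all arrows pointing forwards. Let \<open>f\<^sub>i\<close> be the sum of the stationary paths at
  \<open>v\<^sub>1, \<dots>, v\<^sub>i\<close>. A path ending in one of these vertices also starts in one of them, so
  \<open>J\<^sub>i = f\<^sub>i A\<close> is a two-sided ideal of \<open>A\<close>. Modulo \<open>J\<^sub>i\<close>, every path ending in \<open>v\<^sub>i\<^sub>+\<^sub>1\<close> is
  stationary, so \<open>J\<^sub>i\<^sub>+\<^sub>1 / J\<^sub>i\<close> is generated as a right ideal by an idempotent \<open>e\<close> with
  \<open>A e = e A e = k e\<close>. Such an ideal \<open>e A\<close> is projective and idempotent, and the radical annihilates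
  \<open>e\<close> because the right ideal of all \<open>x\<close> with \<open>x e = 0\<close> is maximal.
\<close>

section \<open>Heredity ideals generated by idempotents\<close>

text \<open>Left multiplication by an idempotent projects onto the right ideal it generates; the
  fixed-point form makes membership equational.\<close>

lemma (in ring) mem_idempotent_right_ideal:
  assumes "e \<in> carrier R" "e \<otimes> e = e"
  shows "x \<in> (\<otimes>) e ` carrier R \<longleftrightarrow> x \<in> carrier R \<and> e \<otimes> x = x"
proof
  assume "x \<in> (\<otimes>) e ` carrier R"
  then obtain b where "b \<in> carrier R" "x = e \<otimes> b" by blast
  then show "x \<in> carrier R \<and> e \<otimes> x = x"
    using assms m_assoc[of e e b] by simp
next
  assume "x \<in> carrier R \<and> e \<otimes> x = x"
  then show "x \<in> (\<otimes>) e ` carrier R"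
    by (intro image_eqI[of _ _ x]) auto
qed

text \<open>The hypothesis \<open>left\<close> says \<open>R e = e R e\<close>. For
  \<open>a = e a\<close> it gives \<open>x a = (x e) a\<close> with first factor fixed by
  \<open>e\<close>, hence closure under multiplication from the left.\<close>

lemma (in ring) ideal_idempotent_right_ideal:
  assumes e: "e \<in> carrier R" "e \<otimes> e = e"
    and left: "\<And>a. a \<in> carrier R \<Longrightarrow> e \<otimes> (a \<otimes> e) = a \<otimes> e"
  shows "ideal ((\<otimes>) e ` carrier R) R"
proof (rule idealI)
  note mem = mem_idempotent_right_ideal[OF e]
  show "ring R" ..
  show "subgroup ((\<otimes>) e ` carrier R) (add_monoid R)"
  proof (rule add.subgroupI)
    show "(\<otimes>) e ` carrier R \<subseteq> carrier R" "(\<otimes>) e ` carrier R \<noteq> {}"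
      using e by auto
    show "\<And>a. a \<in> (\<otimes>) e ` carrier R \<Longrightarrow> \<ominus> a \<in> (\<otimes>) e ` carrier R"
      unfolding mem using e by (simp add: r_minus)
    show "\<And>a b. \<lbrakk>a \<in> (\<otimes>) e ` carrier R; b \<in> (\<otimes>) e ` carrier R\<rbrakk> \<Longrightarrow>
        a \<oplus> b \<in> (\<otimes>) e ` carrier R"
      unfolding mem using e by (simp add: r_distr)
  qed
  fix a x assume "a \<in> (\<otimes>) e ` carrier R" and x: "x \<in> carrier R"
  then have a: "a \<in> carrier R" "e \<otimes> a = a"
    unfolding mem by auto
  show "a \<otimes> x \<in> (\<otimes>) e ` carrier R"
    unfolding mem using a x e m_assoc[of e a x] by simp
  have xa: "x \<otimes> a = (x \<otimes> e) \<otimes> a"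
    using a x e m_assoc[of x e a] by simp
  then have "e \<otimes> (x \<otimes> a) = x \<otimes> a"
    using a x e m_assoc[of e "x \<otimes> e" a] left[OF x] by simp
  then show "x \<otimes> a \<in> (\<otimes>) e ` carrier R"
    unfolding mem using a x by simp
qed

text \<open>By \<open>left\<close> and \<open>div\<close>, \<open>R e = e R e\<close> is a division
  ring. Projectivity holds because \<open>e R\<close> is a direct summand of \<open>R\<close>, and
  the radical condition comes from a maximal right ideal whose elements satisfy
  \<open>x e = 0\<close>.\<close>

lemma (in ring) heredity_ideal_idempotent:
  assumes e: "e \<in> carrier R" "e \<otimes> e = e" "e \<noteq> \<zero>"
    and left: "\<And>a. a \<in> carrier R \<Longrightarrow> e \<otimes> (a \<otimes> e) = a \<otimes> e"
    and div: "\<And>a. a \<in> carrier R \<Longrightarrow> a \<otimes> e \<noteq> \<zero> \<Longrightarrow> \<exists>b\<in>carrier R. (a \<otimes> e) \<otimes> b = e"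
  shows "heredity_ideal ((\<otimes>) e ` carrier R) R"
proof -
  define J where "J = (\<otimes>) e ` carrier R"
  note mem = mem_idempotent_right_ideal[OF e(1,2), folded J_def]
  have eJ: "e \<in> J"
    using e mem by simp
  have J_ideal: "ideal J R"
    unfolding J_def by (rule ideal_idempotent_right_ideal) (use e left in auto)
  have JJ: "ideal_prod R J J = J"
  proof
    show "ideal_prod R J J \<subseteq> J"
      using ideal_prod_inter[OF J_ideal J_ideal] by simp
    show "J \<subseteq> ideal_prod R J J"
    proof
      fix x assume "x \<in> J"
      then show "x \<in> ideal_prod R J J"
        using ideal_prod.prod[OF eJ \<open>x \<in> J\<close>, of R] mem by simp
    qed
  qed
  \<comment> \<open>a two-sided ideal, the kernel of the map from \<open>R\<close> onto the division ring \<open>e R e\<close>\<close>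
  define M where "M = {x \<in> carrier R. x \<otimes> e = \<zero>}"
  have M_max: "maximal_right_ideal M R"
    unfolding maximal_right_ideal_def
  proof (intro conjI allI impI)
    show "right_ideal M R"
    proof (intro right_ideal.intro additive_subgroup.intro right_ideal_axioms.intro)
      show "ring R" ..
      show "subgroup M (add_monoid R)"
      proof (rule add.subgroupI)
        show "M \<subseteq> carrier R" "M \<noteq> {}"
          unfolding M_def using e by auto
        show "\<And>a. a \<in> M \<Longrightarrow> \<ominus> a \<in> M"
          unfolding M_def using e by (simp add: l_minus)
        show "\<And>a b. \<lbrakk>a \<in> M; b \<in> M\<rbrakk> \<Longrightarrow> a \<oplus> b \<in> M"
          unfolding M_def using e by (simp add: l_distr)
      qed
      fix x a assume x: "x \<in> M" and a: "a \<in> carrier R"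
      have xc: "x \<in> carrier R" "x \<otimes> e = \<zero>"
        using x unfolding M_def by auto
      \<comment> \<open>By \<open>left\<close> an extra \<open>e\<close> fits between
        \<open>x\<close> and \<open>a\<close>, so that \<open>x e = 0\<close> applies.\<close>
      have "x \<otimes> a \<otimes> e = x \<otimes> (e \<otimes> (a \<otimes> e))"
        using xc a e left[OF a] m_assoc by simp
      also have "\<dots> = (x \<otimes> e) \<otimes> (a \<otimes> e)"
        using xc(1) a e m_assoc by simp
      also have "\<dots> = \<zero>"
        using xc a e by simp
      finally show "x \<otimes> a \<in> M"
        unfolding M_def using xc a by simp
    qed
    have "e \<notin> M"
      using e unfolding M_def by simp
    then show "M \<noteq> carrier R"
      using e by blast
    fix K assume K: "right_ideal K R" and MK: "M \<subseteq> K"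
    interpret K: right_ideal K R by fact
    show "K = M \<or> K = carrier R"
    proof (cases "K \<subseteq> M")
      case False
      \<comment> \<open>\<open>div\<close> turns \<open>z\<close> into \<open>e\<close>, so
        \<open>e\<close> lies in \<open>K\<close>; \<open>\<one> \<ominus> e\<close> lies in
        \<open>M\<close> because \<open>e\<close> is idempotent. Their sum is the unit.\<close>
      then obtain z where z: "z \<in> K" "z \<notin> M" by blast
      have zc: "z \<in> carrier R"
        using z K.a_subset by auto
      then have "z \<otimes> e \<noteq> \<zero>"
        using z unfolding M_def by auto
      then obtain b where b: "b \<in> carrier R" "z \<otimes> e \<otimes> b = e"
        using div[OF zc] by blast
      then have eK: "e \<in> K"
        using K.r_closed[OF K.r_closed[OF z(1) e(1)] b(1)] by simp
      have "\<one> \<ominus> e \<in> M"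
        unfolding M_def using e by (simp add: a_minus_def l_distr l_minus r_neg)
      then have "(\<one> \<ominus> e) \<oplus> e \<in> K"
        using MK eK by (simp add: subsetD)
      then have one: "\<one> \<in> K"
        using e by (simp add: a_minus_def a_assoc l_neg)
      have "carrier R \<subseteq> K"
        using K.r_closed[OF one] by auto
      then show ?thesis
        using K.a_subset by auto
    qed (use MK in auto)
  qed
  have rad: "r \<in> carrier R \<and> r \<otimes> e = \<zero>" if "r \<in> jacobson_radical R" for r
    using that M_max unfolding jacobson_radical_def M_def by blast
  have J_rad: "x \<in> carrier R \<and> x \<otimes> e = \<zero>" if "x \<in> ideal_prod R J (jacobson_radical R)" for x
    using that
  proof induct
    case (prod i j)
    then have "i \<in> carrier R" "j \<in> carrier R" "j \<otimes> e = \<zero>"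
      using mem rad by auto
    then show ?case using e m_assoc[of i j e] by simp
  next
    case (sum s1 s2)
    then show ?case using e by (simp add: l_distr)
  qed
  \<comment> \<open>Elements of \<open>J\<close> on the right have the form \<open>e j\<close>, and
    the left factor already annihilates \<open>e\<close>.\<close>
  have J_rad_J: "x = \<zero>" if "x \<in> ideal_prod R (ideal_prod R J (jacobson_radical R)) J" for x
    using that
  proof induct
    case (prod i j)
    then have "i \<in> carrier R" "i \<otimes> e = \<zero>" "j \<in> carrier R" "e \<otimes> j = j"
      using mem J_rad by auto
    then show ?case using e m_assoc[of i e j] by simp
  qed simp
  \<comment> \<open>\<open>ideal_prod\<close> contains only products and sums of them, so zero must
    be exhibited as a product.\<close>
  have zero_rad: "\<zero> \<in> jacobson_radical R"
    unfolding jacobson_radical_def maximal_right_ideal_def right_ideal_def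
    by (auto intro: additive_subgroup.zero_closed)
  have zero_J: "\<zero> \<in> J"
    using mem e by simp
  have "\<zero> \<in> ideal_prod R (ideal_prod R J (jacobson_radical R)) J"
    using ideal_prod.prod[OF ideal_prod.prod[OF zero_J zero_rad, of R] zero_J, of R] by simp
  then have JradJ: "ideal_prod R (ideal_prod R J (jacobson_radical R)) J = {\<zero>}"
    using J_rad_J by blast
  interpret J: ideal J R by (rule J_ideal)
  have "abelian_group (right_ideal_module R J)"
  proof (rule abelian_groupI)
    fix x assume "x \<in> carrier (right_ideal_module R J)"
    then show "\<exists>y\<in>carrier (right_ideal_module R J).
        y \<oplus>\<^bsub>right_ideal_module R J\<^esub> x = \<zero>\<^bsub>right_ideal_module R J\<^esub>"
      by (intro bexI[of _ "\<ominus> x"]) (auto simp: right_ideal_module_def l_neg)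
  qed (auto simp: right_ideal_module_def a_ac)
  then have module: "right_module R (right_ideal_module R J)"
    by (intro right_module.intro right_module_axioms.intro ring_axioms)
       (auto simp: right_ideal_module_def J.I_r_closed l_distr r_distr m_assoc)
  have "projective_right_module R (right_ideal_module R J)"
    unfolding projective_right_module_def
  proof (intro conjI module exI[of _ "{e}"] bexI ballI)
    \<comment> \<open>The free module of rank one is \<open>R\<close>; \<open>e\<close> only labels
      its basis element, since labels come from the element type of the module. Left multiplication
      by \<open>e\<close> splits the inclusion of \<open>e R\<close>.\<close>
    let ?\<iota> = "\<lambda>x y. if y = e then x else \<zero>" and ?\<pi> = "\<lambda>f. e \<otimes> f e"
    show "?\<iota> \<in> right_module_hom R (right_ideal_module R J) (free_right_module R {e})"
    proof -
      have "finite {y. (if y = e then x else \<zero>) \<noteq> \<zero>}" for x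
        by (rule finite_subset[of _ "{e}"]) auto
      then show ?thesis
        unfolding right_module_hom_def right_ideal_module_def free_right_module_def
        by (auto simp: Pi_iff fun_eq_iff J.Icarr split: if_splits)
    qed
    show "?\<pi> \<in> right_module_hom R (free_right_module R {e}) (right_ideal_module R J)"
      using e by (auto simp: right_module_hom_def right_ideal_module_def free_right_module_def
          J_def r_distr m_assoc)
    fix x assume "x \<in> carrier (right_ideal_module R J)"
    then show "?\<pi> (?\<iota> x) = x"
      using mem by (simp add: right_ideal_module_def)
  qed
  then show ?thesis
    unfolding heredity_ideal_def J_def[symmetric] using J_ideal JJ JradJ by blast
qed

section \<open>Quotient rings and chains of ideals generated by idempotents\<close>

lemma (in ideal) quot_simps:
  "carrier (R Quot I) = (+>) I ` carrier R"
  "x \<in> carrier R \<Longrightarrow> y \<in> carrier R \<Longrightarrow> (I +> x) \<otimes>\<^bsub>R Quot I\<^esub> (I +> y) = I +> x \<otimes> y"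
  "x \<in> carrier R \<Longrightarrow> y \<in> carrier R \<Longrightarrow> (I +> x) \<oplus>\<^bsub>R Quot I\<^esub> (I +> y) = I +> (x \<oplus> y)"
  "\<one>\<^bsub>R Quot I\<^esub> = I +> \<one>"
  "\<zero>\<^bsub>R Quot I\<^esub> = I +> \<zero>"
  \<comment> \<open>The zero of the quotient is \<open>I\<close> itself; as the coset of zero it can
    be compared with other cosets by \<open>coset_eq_iff\<close>.\<close>
  using a_coset_add_zero[OF a_subset]
  by (auto simp: FactRing_simps rcoset_mult_add a_rcos_sum)

lemma (in ideal) coset_eq_iff:
  assumes "x \<in> carrier R" "y \<in> carrier R"
  shows "I +> x = I +> y \<longleftrightarrow> x \<ominus> y \<in> I"
  using assms quotient_eq_iff_same_a_r_cos[OF ideal_axioms] by simp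

text \<open>Modulo \<open>J i\<close>, the element \<open>f (Suc i)\<close> is a nonzero idempotent
  to which \<open>heredity_ideal_idempotent\<close> applies: \<open>left\<close> is inherited by the
  quotient, and \<open>div\<close> is the division condition there.\<close>

lemma (in ring) idempotent_heredity_chain:
  fixes f :: "nat \<Rightarrow> 'a"
  defines "J \<equiv> \<lambda>i. (\<otimes>) (f i) ` carrier R"
  assumes carr: "\<And>i. i \<le> n \<Longrightarrow> f i \<in> carrier R"
    and left: "\<And>i a. \<lbrakk>i \<le> n; a \<in> carrier R\<rbrakk> \<Longrightarrow> f i \<otimes> (a \<otimes> f i) = a \<otimes> f i"
    and absorb: "\<And>i. i < n \<Longrightarrow> f i \<otimes> f (Suc i) = f i"
    and distinct: "\<And>i. i < n \<Longrightarrow> f (Suc i) \<noteq> f i"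
    and div: "\<And>i a. \<lbrakk>i < n; a \<in> carrier R; a \<otimes> f (Suc i) \<notin> J i\<rbrakk> \<Longrightarrow>
      \<exists>b\<in>carrier R. a \<otimes> f (Suc i) \<otimes> b \<ominus> f (Suc i) \<in> J i"
  shows "i \<le> n \<Longrightarrow> ideal (J i) R"
    and "i < n \<Longrightarrow> J i \<subset> J (Suc i)"
    and "i < n \<Longrightarrow> heredity_ideal ((\<lambda>x. J i +> x) ` J (Suc i)) (R Quot J i)"
proof -
  have idem: "f i \<otimes> f i = f i" if "i \<le> n" for i
    using left[OF that, of \<one>] carr[OF that] by simp
  have mem: "x \<in> J i \<longleftrightarrow> x \<in> carrier R \<and> f i \<otimes> x = x" if "i \<le> n" for x i
    unfolding J_def by (rule mem_idempotent_right_ideal) (use that carr idem in auto)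
  show J_ideal: "ideal (J i) R" if "i \<le> n" for i
    unfolding J_def by (rule ideal_idempotent_right_ideal) (use that carr idem left in auto)
  assume i: "i < n"
  let ?e = "f (Suc i)" and ?B = "R Quot J i"
  have fc: "f i \<in> carrier R" "?e \<in> carrier R"
    using carr i by auto
  \<comment> \<open>\<open>left\<close> for the larger idempotent, applied to \<open>f i\<close>,
    turns \<open>absorb\<close> into absorption from the other side, which yields the
    inclusion.\<close>
  have e_f: "?e \<otimes> f i = f i"
    using left[of "Suc i" "f i"] fc absorb[OF i] i by simp
  \<comment> \<open>Membership would mean \<open>f i \<otimes> ?e = ?e\<close>, whereas
    \<open>absorb\<close> gives \<open>f i\<close>.\<close>
  have e_notin: "?e \<notin> J i"
    using mem[of i ?e] i absorb[OF i] distinct[OF i] by simp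
  have "x \<in> J (Suc i)" if "x \<in> J i" for x
  proof -
    have x: "x \<in> carrier R" "f i \<otimes> x = x"
      using that mem i by auto
    then have "?e \<otimes> x = x"
      using m_assoc[OF fc(2,1) x(1)] e_f by simp
    then show ?thesis using x mem i by simp
  qed
  moreover have "?e \<in> J (Suc i)"
    using mem idem fc i by simp
  ultimately show "J i \<subset> J (Suc i)"
    using e_notin by auto
  interpret Ji: ideal "J i" R
    using J_ideal i by simp
  interpret B: ring ?B
    by (rule Ji.quotient_is_ring)
  let ?q = "\<lambda>x. J i +> x"
  have "heredity_ideal ((\<otimes>\<^bsub>?B\<^esub>) (?q ?e) ` carrier ?B) ?B"
  proof (rule B.heredity_ideal_idempotent)
    show "?q ?e \<in> carrier ?B" "?q ?e \<otimes>\<^bsub>?B\<^esub> ?q ?e = ?q ?e"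
      using fc idem i by (auto simp: Ji.quot_simps)
    show "?q ?e \<noteq> \<zero>\<^bsub>?B\<^esub>"
      using e_notin fc by (simp add: Ji.quot_simps Ji.coset_eq_iff a_minus_def)
  next
    fix a assume "a \<in> carrier ?B"
    then obtain x where x: "x \<in> carrier R" "a = ?q x"
      by (auto simp: Ji.quot_simps)
    show "?q ?e \<otimes>\<^bsub>?B\<^esub> (a \<otimes>\<^bsub>?B\<^esub> ?q ?e) = a \<otimes>\<^bsub>?B\<^esub> ?q ?e"
      using x fc left[of "Suc i" x] i by (simp add: Ji.quot_simps)
    assume "a \<otimes>\<^bsub>?B\<^esub> ?q ?e \<noteq> \<zero>\<^bsub>?B\<^esub>"
    then have "x \<otimes> ?e \<notin> J i"
      using x fc by (simp add: Ji.quot_simps Ji.coset_eq_iff a_minus_def)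
    then obtain b where "b \<in> carrier R" "x \<otimes> ?e \<otimes> b \<ominus> ?e \<in> J i"
      using div[OF i x(1)] by blast
    then show "\<exists>b\<in>carrier ?B. a \<otimes>\<^bsub>?B\<^esub> ?q ?e \<otimes>\<^bsub>?B\<^esub> b = ?q ?e"
      using x fc by (intro bexI[of _ "?q b"]) (auto simp: Ji.quot_simps Ji.coset_eq_iff)
  qed
  moreover have "(\<otimes>\<^bsub>?B\<^esub>) (?q ?e) ` carrier ?B = ?q ` J (Suc i)"
  proof -
    have JS: "J (Suc i) = (\<otimes>) ?e ` carrier R"
      by (simp only: J_def)
    show ?thesis
      unfolding JS Ji.quot_simps(1) image_image
      by (rule image_cong[OF refl]) (rule Ji.quot_simps(2)[OF fc(2)])
  qed
  ultimately show "heredity_ideal (?q ` J (Suc i)) ?B"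
    by (simp only:)
qed

section \<open>Finite-dimensional algebras and their quotients\<close>

text \<open>Every element of the scalar type is a scalar, so the module axioms lose their membership
  conditions on scalars.\<close>

lemma k_algebraI:
  fixes A :: "('k::field, 'a, 'm) module_scheme" (structure)
  assumes ring: "ring A"
    and "\<And>c x. x \<in> carrier A \<Longrightarrow> c \<odot> x \<in> carrier A"
    and "\<And>c d x. x \<in> carrier A \<Longrightarrow> (c + d) \<odot> x = c \<odot> x \<oplus> d \<odot> x"
    and "\<And>c x y. \<lbrakk>x \<in> carrier A; y \<in> carrier A\<rbrakk> \<Longrightarrow> c \<odot> (x \<oplus> y) = c \<odot> x \<oplus> c \<odot> y"
    and "\<And>c d x. x \<in> carrier A \<Longrightarrow> (c * d) \<odot> x = c \<odot> (d \<odot> x)"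
    and "\<And>x. x \<in> carrier A \<Longrightarrow> 1 \<odot> x = x"
    and "\<And>c x y. \<lbrakk>x \<in> carrier A; y \<in> carrier A\<rbrakk> \<Longrightarrow> (c \<odot> x) \<otimes> y = c \<odot> (x \<otimes> y)"
    and "\<And>c x y. \<lbrakk>x \<in> carrier A; y \<in> carrier A\<rbrakk> \<Longrightarrow> x \<otimes> (c \<odot> y) = c \<odot> (x \<otimes> y)"
  shows "k_algebra A"
proof (rule k_algebra.intro)
  show "ring A" by fact
  show "module (ring_of_type_algebra :: 'k ring) A"
    by (rule moduleI)
       (use assms in \<open>simp_all add: ring_of_type_algebra_def ring.axioms(1)
          cring_from_type_algebra[unfolded ring_of_type_algebra_def]\<close>)
  show "k_algebra_axioms A"
    by (rule k_algebra_axioms.intro) (use assms in auto)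
qed

context k_algebra
begin

lemma is_ring: "ring A"
  by (rule k_algebra.axioms(1)[OF k_algebra_axioms])

lemma scalar_closed: "x \<in> carrier A \<Longrightarrow> c \<odot> x \<in> carrier A"
  using smult_closed[of c x] by (simp add: ring_of_type_algebra_def)

lemma scalar_distr_left: "x \<in> carrier A \<Longrightarrow> (c + d) \<odot> x = c \<odot> x \<oplus> d \<odot> x"
  using smult_l_distr[of c d x] by (simp add: ring_of_type_algebra_def)

lemma scalar_distr_right: "\<lbrakk>x \<in> carrier A; y \<in> carrier A\<rbrakk> \<Longrightarrow> c \<odot> (x \<oplus> y) = c \<odot> x \<oplus> c \<odot> y"
  using smult_r_distr[of c x y] by (simp add: ring_of_type_algebra_def)

lemma scalar_assoc: "x \<in> carrier A \<Longrightarrow> (c * d) \<odot> x = c \<odot> (d \<odot> x)"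
  using smult_assoc1[of c d x] by (simp add: ring_of_type_algebra_def)

lemma scalar_one: "x \<in> carrier A \<Longrightarrow> 1 \<odot> x = x"
  using smult_one[of x] by (simp add: ring_of_type_algebra_def)

lemma scalar_zero: "x \<in> carrier A \<Longrightarrow> 0 \<odot> x = \<zero>"
  using smult_l_null[of x] by (simp add: ring_of_type_algebra_def)

end

text \<open>By \<open>scalar\<close>, all left multiples of \<open>f (Suc i)\<close> are scalar
  multiples of it modulo \<open>J i\<close>. Invertibility of nonzero scalars then gives the
  condition \<open>div\<close> of \<open>idempotent_heredity_chain\<close>.\<close>

lemma (in fin_dim_algebra) quasi_hereditary_of_idempotent_chain:
  fixes f :: "nat \<Rightarrow> 'a"
  assumes carr: "\<And>i. i \<le> n \<Longrightarrow> f i \<in> carrier A"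
    and ends: "f 0 = \<zero>" "f n = \<one>"
    and left: "\<And>i a. \<lbrakk>i \<le> n; a \<in> carrier A\<rbrakk> \<Longrightarrow> f i \<otimes> (a \<otimes> f i) = a \<otimes> f i"
    and absorb: "\<And>i. i < n \<Longrightarrow> f i \<otimes> f (Suc i) = f i"
    and distinct: "\<And>i. i < n \<Longrightarrow> f (Suc i) \<noteq> f i"
    and scalar: "\<And>i a. \<lbrakk>i < n; a \<in> carrier A\<rbrakk> \<Longrightarrow>
      \<exists>c. \<exists>b\<in>carrier A. a \<otimes> f (Suc i) = c \<odot> f (Suc i) \<oplus> f i \<otimes> b"
  shows "quasi_hereditary A"
proof -
  note ra = is_ring
  note [simp] = ring.ring_simprules(1,5)[OF ra]
  define J where "J i = (\<otimes>) (f i) ` carrier A" for i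
  have div: "\<exists>b\<in>carrier A. a \<otimes> f (Suc i) \<otimes> b \<ominus> f (Suc i) \<in> J i"
    if i: "i < n" and a: "a \<in> carrier A" and notin: "a \<otimes> f (Suc i) \<notin> J i" for i a
  proof -
    let ?e = "f (Suc i)"
    have fc: "f i \<in> carrier A" "?e \<in> carrier A"
      using carr i by auto
    have ee: "?e \<otimes> ?e = ?e"
      using left[of "Suc i" \<one>] fc i ra by (simp add: ring.ring_simprules)
    obtain c b where b: "b \<in> carrier A" and cb: "a \<otimes> ?e = c \<odot> ?e \<oplus> f i \<otimes> b"
      using scalar[OF i a] by blast
    have "c \<noteq> 0"
    proof
      assume "c = 0"
      then have "a \<otimes> ?e = f i \<otimes> b"
        using cb fc b ra by (simp add: scalar_zero ring.ring_simprules)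
      then show False
        using notin b unfolding J_def by blast
    qed
    \<comment> \<open>A right inverse modulo \<open>J i\<close>: it cancels the scalar
      \<open>c\<close>, while the summand with left factor \<open>f i\<close> stays in
      \<open>J i\<close>.\<close>
    define d where "d = inverse c \<odot> ?e"
    have d: "d \<in> carrier A"
      unfolding d_def using fc by (simp add: scalar_closed)
    have ced: "(c \<odot> ?e) \<otimes> d = ?e"
      unfolding d_def using fc \<open>c \<noteq> 0\<close>
      by (simp add: smult_mult_left smult_mult_right ee scalar_closed scalar_one
          scalar_assoc[symmetric])
    have "a \<otimes> ?e \<otimes> d \<ominus> ?e = (?e \<oplus> f i \<otimes> b \<otimes> d) \<ominus> ?e"
      unfolding cb using ring.ring_simprules(13)[OF ra, of "c \<odot> ?e" "f i \<otimes> b" d]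
      by (simp add: ced fc d b scalar_closed)
    also have "\<dots> = f i \<otimes> (b \<otimes> d)"
      using ra fc b d by (simp add: ring.ring_simprules)
    finally show ?thesis
      using b d unfolding J_def by (intro bexI[of _ d]) auto
  qed
  have J0: "J 0 = {\<zero>}"
    unfolding J_def ends using ra by (auto simp: ring.ring_simprules intro!: image_eqI[of _ _ \<zero>])
  have Jn: "J n = carrier A"
    unfolding J_def ends using ra by (auto simp: ring.ring_simprules intro: image_eqI)
  note chain = ring.idempotent_heredity_chain[OF ra, of n f, folded J_def,
      OF carr left absorb distinct div]
  show ?thesis
    unfolding quasi_hereditary_def
    by (intro conjI fin_dim_algebra_axioms exI[of _ n] exI[of _ J] J0 Jn allI impI chain)
qed

section \<open>The quotient of an algebra by an ideal\<close>

lemma quotient_algebra_simps: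
  fixes A :: "('k, 'a, 'm) module_scheme" (structure)
  assumes "ideal I A"
  shows "carrier (quotient_algebra A I) = (+>) I ` carrier A"
    and "x \<in> carrier A \<Longrightarrow> y \<in> carrier A \<Longrightarrow>
      (I +> x) \<otimes>\<^bsub>quotient_algebra A I\<^esub> (I +> y) = I +> x \<otimes> y"
    and "x \<in> carrier A \<Longrightarrow> y \<in> carrier A \<Longrightarrow>
      (I +> x) \<oplus>\<^bsub>quotient_algebra A I\<^esub> (I +> y) = I +> (x \<oplus> y)"
    and "\<one>\<^bsub>quotient_algebra A I\<^esub> = I +> \<one>"
    and "\<zero>\<^bsub>quotient_algebra A I\<^esub> = I +> \<zero>"
  using assms unfolding quotient_algebra_def by (simp_all add: ideal.quot_simps)

text \<open>The action is a union over all representatives of a coset. It is well defined because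
  \<open>c \<odot> h = (c \<odot> \<one>) \<otimes> h\<close> keeps scalar multiples of members of
  \<open>I\<close> in \<open>I\<close>.\<close>

lemma (in k_algebra) quotient_algebra_smult:
  assumes I: "ideal I A" and x: "x \<in> carrier A"
  shows "c \<odot>\<^bsub>quotient_algebra A I\<^esub> (I +>\<^bsub>A\<^esub> x) = I +>\<^bsub>A\<^esub> (c \<odot> x)"
proof -
  interpret I: ideal I A by fact
  have "I +>\<^bsub>A\<^esub> (c \<odot> y) = I +>\<^bsub>A\<^esub> (c \<odot> x)" if "y \<in> I +>\<^bsub>A\<^esub> x" for y
  proof -
    obtain h where h: "h \<in> I" "y = h \<oplus> x"
      using \<open>y \<in> I +>\<^bsub>A\<^esub> x\<close> by (auto simp: a_r_coset_def')
    have hc: "h \<in> carrier A"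
      using h by (rule_tac I.Icarr)
    have "c \<odot> h = (c \<odot> \<one>) \<otimes> h"
      using hc is_ring by (simp add: smult_mult_left ring.ring_simprules)
    also have "\<dots> \<in> I"
      using h is_ring by (intro I.I_l_closed) (simp_all add: scalar_closed ring.ring_simprules)
    finally have "c \<odot> h \<in> I" .
    moreover have "c \<odot> y \<ominus> c \<odot> x = c \<odot> h"
      using h hc x is_ring by (simp add: scalar_distr_right scalar_closed ring.ring_simprules)
    ultimately show ?thesis
      using h hc x is_ring by (simp add: I.coset_eq_iff scalar_closed ring.ring_simprules)
  qed
  moreover have "x \<in> I +>\<^bsub>A\<^esub> x"
    using x by (rule I.a_rcos_self)
  ultimately have "(\<Union>y\<in>I +>\<^bsub>A\<^esub> x. I +>\<^bsub>A\<^esub> (c \<odot> y)) = I +>\<^bsub>A\<^esub> (c \<odot> x)"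
    by blast
  then show ?thesis
    unfolding quotient_algebra_def by simp
qed

lemma (in k_algebra) k_algebra_quotient:
  assumes I: "ideal I A"
  shows "k_algebra (quotient_algebra A I)"
proof -
  interpret I: ideal I A by fact
  interpret Q: ring "A Quot I"
    by (rule I.quotient_is_ring)
  \<comment> \<open>Only the record type differs from \<open>A Quot I\<close>, so the ring axioms
    transfer field by field.\<close>
  have "ring (quotient_algebra A I)"
  proof (rule ringI)
    show "abelian_group (quotient_algebra A I)"
    proof (rule abelian_groupI)
      fix x assume "x \<in> carrier (quotient_algebra A I)"
      then show "\<exists>y\<in>carrier (quotient_algebra A I).
          y \<oplus>\<^bsub>quotient_algebra A I\<^esub> x = \<zero>\<^bsub>quotient_algebra A I\<^esub>"
        by (intro bexI[of _ "\<ominus>\<^bsub>A Quot I\<^esub> x"]) (simp_all add: quotient_algebra_def Q.l_neg)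
    qed (simp_all add: quotient_algebra_def Q.a_ac)
    show "Group.monoid (quotient_algebra A I)"
      by (rule monoidI) (simp_all add: quotient_algebra_def Q.m_assoc)
  qed (simp_all add: quotient_algebra_def Q.l_distr Q.r_distr)
  then show ?thesis
    by (rule k_algebraI)
       (auto simp: quotient_algebra_simps[OF I] quotient_algebra_smult[OF I] is_ring
         scalar_closed scalar_distr_left scalar_distr_right scalar_assoc scalar_one
         smult_mult_left smult_mult_right ring.ring_simprules)
qed

section \<open>Finite spanning families\<close>

lemma (in k_algebra) is_abelian_monoid: "abelian_monoid A"
  by (rule abelian_group.axioms(1)[OF ring.axioms(1)[OF is_ring]])

text \<open>The unqualified names \<open>a_assoc\<close>, \<open>finsum_insert\<close> etc. refer to the ring of scalars here.\<close>

lemmas (in k_algebra) algebra_a_assoc = abelian_monoid.a_assoc[OF is_abelian_monoid]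
lemmas (in k_algebra) algebra_finsum_insert = abelian_monoid.finsum_insert[OF is_abelian_monoid]
lemmas (in k_algebra) algebra_finsum_closed = abelian_monoid.finsum_closed[OF is_abelian_monoid]
lemmas (in k_algebra) algebra_finsum_cong = abelian_monoid.finsum_cong'[OF is_abelian_monoid]

text \<open>The locale asks for sums over a set of elements, whereas the image of a spanning set is
  naturally an indexed family. Repetitions in the family are absorbed by adding
  coefficients.\<close>

lemma (in k_algebra) fin_dim_algebraI:
  assumes W: "finite W" and v: "v \<in> W \<rightarrow> carrier A"
    and span: "\<And>x. x \<in> carrier A \<Longrightarrow> \<exists>c. x = (\<Oplus>w\<in>W. c w \<odot> v w)"
  shows "fin_dim_algebra A"
proof -
  note [simp] = scalar_closed
  have collect: "\<exists>d. (\<Oplus>w\<in>W. c w \<odot> v w) = (\<Oplus>b\<in>v ` W. d b \<odot> b)"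
    if "finite W" "v \<in> W \<rightarrow> carrier A" for W c
    using that
  proof induction
    case empty
    then show ?case by simp
  next
    case (insert w W)
    then obtain d where d: "(\<Oplus>w\<in>W. c w \<odot> v w) = (\<Oplus>b\<in>v ` W. d b \<odot> b)"
      by auto
    have vW: "v ` W \<subseteq> carrier A" and vw: "v w \<in> carrier A"
      using insert by auto
    \<comment> \<open>Removing \<open>v w\<close> from the image frees its coefficient: updating
      \<open>d\<close> there does not touch the remaining sum.\<close>
    let ?B = "v ` W - {v w}" and ?d' = "\<lambda>x. d(v w := x)"
    have rest: "(\<Oplus>b\<in>?B. ?d' x b \<odot> b) = (\<Oplus>b\<in>?B. d b \<odot> b)" for x
      by (rule algebra_finsum_cong) (use vW in auto)
    have split: "(\<Oplus>b\<in>insert (v w) ?B. ?d' x b \<odot> b) = x \<odot> v w \<oplus> (\<Oplus>b\<in>?B. d b \<odot> b)" for x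
      unfolding rest[of x, symmetric]
      by (subst algebra_finsum_insert) (use insert vW vw in \<open>auto simp: Pi_iff\<close>)
    have closed: "(\<Oplus>b\<in>?B. d b \<odot> b) \<in> carrier A"
      by (rule algebra_finsum_closed) (use vW in auto)
    have "(\<Oplus>w\<in>insert w W. c w \<odot> v w) = c w \<odot> v w \<oplus> (\<Oplus>b\<in>v ` W. d b \<odot> b)"
      unfolding d[symmetric]
      by (rule algebra_finsum_insert) (use insert vW vw in \<open>auto simp: Pi_iff\<close>)
    also have "\<exists>x. \<dots> = x \<odot> v w \<oplus> (\<Oplus>b\<in>?B. d b \<odot> b)"
    proof (cases "v w \<in> v ` W")
      case True
      then have "insert (v w) ?B = v ` W" by auto
      then have "(\<Oplus>b\<in>v ` W. d b \<odot> b) = d (v w) \<odot> v w \<oplus> (\<Oplus>b\<in>?B. d b \<odot> b)"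
        using split[of "d (v w)"] by (simp only: fun_upd_triv)
      then have "c w \<odot> v w \<oplus> (\<Oplus>b\<in>v ` W. d b \<odot> b)
          = (c w + d (v w)) \<odot> v w \<oplus> (\<Oplus>b\<in>?B. d b \<odot> b)"
        using vw closed by (simp add: scalar_distr_left algebra_a_assoc)
      then show ?thesis by blast
    qed auto
    finally obtain x where "(\<Oplus>w\<in>insert w W. c w \<odot> v w) = (\<Oplus>b\<in>insert (v w) ?B. ?d' x b \<odot> b)"
      unfolding split by blast
    then show ?case by (intro exI[of _ "?d' x"]) simp
  qed
  show ?thesis
  proof (intro fin_dim_algebra.intro fin_dim_algebra_axioms.intro k_algebra_axioms)
    show "\<exists>B. finite B \<and> B \<subseteq> carrier A \<and> (\<forall>x\<in>carrier A. \<exists>c. x = (\<Oplus>b\<in>B. c b \<odot> b))"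
    proof (intro exI[of _ "v ` W"] conjI ballI)
      fix x assume "x \<in> carrier A"
      then obtain c where "x = (\<Oplus>w\<in>W. c w \<odot> v w)"
        using span by blast
      then show "\<exists>d. x = (\<Oplus>b\<in>v ` W. d b \<odot> b)"
        using collect[OF W v, of c] by simp
    qed (use W v in auto)
  qed
qed

text \<open>The coset map respects finite linear combinations, so cosets of a spanning set span.
  Different elements may share a coset, hence the indexed criterion
  \<open>fin_dim_algebraI\<close>.\<close>

lemma (in fin_dim_algebra) fin_dim_algebra_quotient:
  assumes I: "ideal I A"
  shows "fin_dim_algebra (quotient_algebra A I)"
proof -
  interpret Q: k_algebra "quotient_algebra A I"
    by (rule k_algebra_quotient[OF I])
  let ?Q = "quotient_algebra A I" and ?q = "\<lambda>x. I +>\<^bsub>A\<^esub> x"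
  note simps = quotient_algebra_simps[OF I] quotient_algebra_smult[OF I]
  obtain B where B: "finite B" "B \<subseteq> carrier A"
    and span: "\<And>x. x \<in> carrier A \<Longrightarrow> \<exists>c. x = (\<Oplus>b\<in>B. c b \<odot> b)"
    using finite_spanning_set by blast
  have hom: "?q (finsum A g W) = finsum ?Q (\<lambda>b. ?q (g b)) W"
    if "finite W" "g \<in> W \<rightarrow> carrier A" for g :: "'a \<Rightarrow> 'a" and W
    using that
  proof induction
    case (insert b W)
    then have IH: "finsum ?Q (\<lambda>b. ?q (g b)) W = ?q (finsum A g W)"
      and g: "g \<in> W \<rightarrow> carrier A" "g b \<in> carrier A"
      by auto
    have "finsum A g W \<in> carrier A"
      using g(1) by (rule algebra_finsum_closed)
    moreover have "finsum A g (insert b W) = g b \<oplus> finsum A g W"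
      by (rule algebra_finsum_insert) (use insert.hyps g in auto)
    moreover have "finsum ?Q (\<lambda>b. ?q (g b)) (insert b W) =
        ?q (g b) \<oplus>\<^bsub>?Q\<^esub> finsum ?Q (\<lambda>b. ?q (g b)) W"
      by (rule Q.algebra_finsum_insert) (use insert.hyps g in \<open>auto simp: simps\<close>)
    ultimately show ?case
      using g by (simp add: IH simps)
  qed (simp add: simps)
  show ?thesis
  proof (rule Q.fin_dim_algebraI[OF B(1), of ?q])
    show "?q \<in> B \<rightarrow> carrier ?Q"
      using B by (auto simp: simps)
    fix U assume "U \<in> carrier ?Q"
    then obtain x where x: "x \<in> carrier A" "U = ?q x"
      by (auto simp: simps)
    obtain c where c: "x = (\<Oplus>b\<in>B. c b \<odot> b)"
      using span[OF x(1)] by blast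
    have "U = finsum ?Q (\<lambda>b. ?q (c b \<odot> b)) B"
      unfolding x(2) c by (rule hom) (use B in \<open>auto simp: scalar_closed\<close>)
    also have "\<dots> = finsum ?Q (\<lambda>b. c b \<odot>\<^bsub>?Q\<^esub> ?q b) B"
      by (rule Q.algebra_finsum_cong) (use B in \<open>auto simp: simps scalar_closed subset_iff\<close>)
    finally show "\<exists>c. U = finsum ?Q (\<lambda>b. c b \<odot>\<^bsub>?Q\<^esub> ?q b) B"
      by blast
  qed
qed

section \<open>Path algebras\<close>

lemma path_algebra_simps:
  "f \<in> carrier (path_algebra Q) \<longleftrightarrow> finite {w. f w \<noteq> 0} \<and> {w. f w \<noteq> 0} \<subseteq> paths Q"
  "f \<oplus>\<^bsub>path_algebra Q\<^esub> g = (\<lambda>w. f w + g w)"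
  "\<zero>\<^bsub>path_algebra Q\<^esub> = (\<lambda>w. 0)"
  "c \<odot>\<^bsub>path_algebra Q\<^esub> f = (\<lambda>w. c * f w)"
  by (simp_all add: path_algebra_def)

text \<open>The ring axioms are a hypothesis, later supplied by an ideal of the path algebra, whose
  locale contains them.\<close>

lemma k_algebra_path_algebra:
  assumes "ring (path_algebra Q :: ('k::field, 'v \<times> 'e list \<Rightarrow> 'k) module)"
  shows "k_algebra (path_algebra Q :: ('k, 'v \<times> 'e list \<Rightarrow> 'k) module)"
proof (rule k_algebraI[OF assms])
  fix c :: 'k and f :: "'v \<times> 'e list \<Rightarrow> 'k" assume "f \<in> carrier (path_algebra Q)"
  then show "c \<odot>\<^bsub>path_algebra Q\<^esub> f \<in> carrier (path_algebra Q)"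
    unfolding path_algebra_simps by (auto elim: finite_subset[rotated])
qed (auto simp: path_algebra_def fun_eq_iff algebra_simps sum_distrib_left)

lemma fin_dim_algebra_path_algebra:
  assumes ring: "ring (path_algebra Q :: ('k::field, 'v \<times> 'e list \<Rightarrow> 'k) module)"
    and fin: "finite (paths Q)"
  shows "fin_dim_algebra (path_algebra Q :: ('k, 'v \<times> 'e list \<Rightarrow> 'k) module)"
proof -
  let ?A = "path_algebra Q :: ('k, 'v \<times> 'e list \<Rightarrow> 'k) module"
  interpret A: k_algebra ?A
    by (rule k_algebra_path_algebra[OF ring])
  have pe: "path_elem w \<in> carrier ?A" if "w \<in> paths Q" for w
    using that by (auto simp: path_algebra_simps path_elem_def)
  have sum: "finsum ?A (\<lambda>w. f w \<odot>\<^bsub>?A\<^esub> path_elem w) W = (\<lambda>w. if w \<in> W then f w else 0)"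
    if "finite W" "W \<subseteq> paths Q" for f W
    using that
  proof induction
    case (insert w W)
    then have "finsum ?A (\<lambda>w. f w \<odot>\<^bsub>?A\<^esub> path_elem w) (insert w W) =
        f w \<odot>\<^bsub>?A\<^esub> path_elem w \<oplus>\<^bsub>?A\<^esub> finsum ?A (\<lambda>w. f w \<odot>\<^bsub>?A\<^esub> path_elem w) W"
      by (intro A.algebra_finsum_insert) (auto intro!: A.scalar_closed pe)
    then show ?case
      using insert by (auto simp: path_algebra_simps path_elem_def fun_eq_iff)
  qed (simp add: path_algebra_simps)
  show ?thesis
  proof (rule A.fin_dim_algebraI[OF fin, of path_elem])
    show "path_elem \<in> paths Q \<rightarrow> carrier ?A"
      using pe by auto
    fix f assume "f \<in> carrier ?A"
    then have "f = finsum ?A (\<lambda>w. f w \<odot>\<^bsub>?A\<^esub> path_elem w) (paths Q)"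
      unfolding sum[OF fin subset_refl] by (auto simp: path_algebra_simps fun_eq_iff)
    then show "\<exists>c. f = finsum ?A (\<lambda>w. c w \<odot>\<^bsub>?A\<^esub> path_elem w) (paths Q)"
      by blast
  qed
qed

section \<open>Sums of stationary paths as idempotents\<close>

definition vertex_idem :: "'v set \<Rightarrow> 'v \<times> 'e list \<Rightarrow> 'k::field" where
  "vertex_idem S = (\<lambda>(u, p). if u \<in> S \<and> p = [] then 1 else 0)"

lemma vertex_idem_carrier:
  fixes Q :: "('v, 'e) pre_digraph"
  assumes "finite S" "S \<subseteq> verts Q"
  shows "(vertex_idem S :: 'v \<times> 'e list \<Rightarrow> 'k::field) \<in> carrier (path_algebra Q)"
proof -
  have "{w. (vertex_idem S :: 'v \<times> 'e list \<Rightarrow> 'k) w \<noteq> 0} = S \<times> {[]}"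
    by (auto simp: vertex_idem_def split: if_splits)
  moreover have "S \<times> {[]} \<subseteq> paths Q"
    using assms by (auto simp: paths_def pre_digraph.awalk_def pre_digraph.cas.simps)
  ultimately show ?thesis
    using assms by (simp add: path_algebra_simps)
qed

lemma vertex_idem_empty: "vertex_idem {} = \<zero>\<^bsub>path_algebra Q\<^esub>"
  by (auto simp: vertex_idem_def path_algebra_def)

lemma vertex_idem_verts: "vertex_idem (verts Q) = \<one>\<^bsub>path_algebra Q\<^esub>"
  by (simp add: vertex_idem_def path_algebra_def)

text \<open>Only the factorization with empty initial segment contributes.\<close>

lemma vertex_idem_mult:
  "vertex_idem S \<otimes>\<^bsub>path_algebra Q\<^esub> f = (\<lambda>(u, p). if u \<in> S then f (u, p) else 0)"
proof -
  have "(\<Sum>i\<le>length p. vertex_idem S (u, take i p) * f (pre_digraph.awlast Q u (take i p), drop i p))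
      = (\<Sum>i\<le>length p. if i = 0 then if u \<in> S then f (u, p) else 0 else 0)" for u p
    by (rule sum.cong) (auto simp: vertex_idem_def pre_digraph.awalk_verts.simps)
  then show ?thesis
    by (simp add: path_algebra_def)
qed

text \<open>Only the factorization with empty final segment contributes.\<close>

lemma mult_vertex_idem:
  "f \<otimes>\<^bsub>path_algebra Q\<^esub> vertex_idem S =
    (\<lambda>(u, p). if pre_digraph.awlast Q u p \<in> S then f (u, p) else 0)"
proof -
  have "(\<Sum>i\<le>length p. f (u, take i p) * vertex_idem S (pre_digraph.awlast Q u (take i p), drop i p))
      = (\<Sum>i\<le>length p. if i = length p
          then if pre_digraph.awlast Q u p \<in> S then f (u, p) else 0 else 0)" for u p
    by (rule sum.cong) (auto simp: vertex_idem_def)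
  then show ?thesis
    by (simp add: path_algebra_def)
qed

section \<open>Topological orderings of toupie quivers\<close>

lemma (in wf_digraph) awalk_start_in_predecessor_closed:
  assumes "awalk u p v" "v \<in> S"
    and closed: "\<And>a. \<lbrakk>a \<in> arcs G; head G a \<in> S\<rbrakk> \<Longrightarrow> tail G a \<in> S"
  shows "u \<in> S"
  using assms(1,2)
proof (induction p arbitrary: u)
  case (Cons a p)
  then show ?case
    using closed[of a] by (auto simp: awalk_Cons_iff)
qed (simp add: awalk_Nil_iff)

text \<open>The end \<open>v\<close> may lie outside \<open>S\<close>; splitting off the last arrow
  leaves a walk that ends in \<open>S\<close>. This serves for a vertex about to be added to
  \<open>S\<close>.\<close>

lemma (in wf_digraph) awalk_nonempty_start_in_predecessor_closed:
  assumes walk: "awalk u p v" and "p \<noteq> []"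
    and v: "\<And>a. \<lbrakk>a \<in> arcs G; head G a = v\<rbrakk> \<Longrightarrow> tail G a \<in> S"
    and closed: "\<And>a. \<lbrakk>a \<in> arcs G; head G a \<in> S\<rbrakk> \<Longrightarrow> tail G a \<in> S"
  shows "u \<in> S"
proof -
  obtain q a where p: "p = q @ [a]"
    using \<open>p \<noteq> []\<close> by (metis rev_exhaust)
  have "awalk u q (awlast u q)" "awalk (awlast u q) [a] v"
    using walk unfolding p awalk_append_iff by auto
  then show ?thesis
    using awalk_start_in_predecessor_closed[OF _ _ closed] v by (auto simp: awalk_Cons_iff awalk_Nil_iff)
qed

text \<open>The list need not exhaust the vertices, so that orderings can be built up one vertex at
  a time.\<close>

definition topological_order :: "('v, 'e) pre_digraph \<Rightarrow> 'v list \<Rightarrow> bool" where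
  "topological_order Q vs \<longleftrightarrow> distinct vs \<and> set vs \<subseteq> verts Q \<and>
     (\<forall>i<length vs. \<forall>a\<in>arcs Q. head Q a = vs ! i \<longrightarrow> tail Q a \<in> set (take i vs))"

lemma topological_order_predecessor_closed:
  assumes "topological_order Q vs" "i \<le> length vs" "a \<in> arcs Q" "head Q a \<in> set (take i vs)"
  shows "tail Q a \<in> set (take i vs)"
proof -
  obtain j where j: "j < i" "head Q a = vs ! j"
    using assms(2,4) by (auto simp: in_set_conv_nth)
  then have "tail Q a \<in> set (take j vs)"
    using assms unfolding topological_order_def by auto
  then show ?thesis
    using j set_take_subset_set_take[of j i vs] by auto
qed

text \<open>The hypothesis is a form of acyclicity. Applied to the vertices not yet listed, it
  provides one whose predecessors are all listed; this one is appended.\<close>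

lemma (in fin_digraph) ex_topological_order:
  assumes "\<And>T. \<lbrakk>T \<subseteq> verts G; T \<noteq> {}\<rbrakk> \<Longrightarrow> \<exists>v\<in>T. \<forall>a\<in>arcs G. head G a = v \<longrightarrow> tail G a \<notin> T"
  shows "\<exists>vs. topological_order G vs \<and> set vs = verts G"
proof -
  have "k \<le> card (verts G) \<Longrightarrow> \<exists>vs. topological_order G vs \<and> length vs = k" for k
  proof (induction k)
    case 0
    show ?case
      by (rule exI[of _ "[]"]) (simp add: topological_order_def)
  next
    case (Suc k)
    then obtain vs where vs: "topological_order G vs" "length vs = k"
      by auto
    then have "distinct vs" "set vs \<subseteq> verts G"
      unfolding topological_order_def by auto
    then have "card (set vs) < card (verts G)"
      using vs Suc.prems by (simp add: distinct_card)
    then have "verts G - set vs \<noteq> {}"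
      by (metis Diff_eq_empty_iff card_mono List.finite_set leD)
    then obtain v where v: "v \<in> verts G - set vs"
      and min: "\<And>a. \<lbrakk>a \<in> arcs G; head G a = v\<rbrakk> \<Longrightarrow> tail G a \<notin> verts G - set vs"
      using assms[of "verts G - set vs"] by blast
    have "topological_order G (vs @ [v])"
      unfolding topological_order_def
    proof (intro conjI allI impI ballI)
      fix i a assume i: "i < length (vs @ [v])" and a: "a \<in> arcs G" "head G a = (vs @ [v]) ! i"
      show "tail G a \<in> set (take i (vs @ [v]))"
      proof (cases "i < length vs")
        case True
        then show ?thesis
          using a vs unfolding topological_order_def by (simp add: nth_append)
      next
        case False
        then show ?thesis
          using i a min[of a] by (simp add: nth_append)
      qed
    qed (use v \<open>distinct vs\<close> \<open>set vs \<subseteq> verts G\<close> in auto)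
    then show ?case
      using vs by (intro exI[of _ "vs @ [v]"]) simp
  qed
  then obtain vs where vs: "topological_order G vs" "length vs = card (verts G)"
    by blast
  then have "set vs = verts G"
    unfolding topological_order_def by (intro card_subset_eq) (auto simp: distinct_card)
  then show ?thesis
    using vs by blast
qed

text \<open>A path ending in the next vertex is stationary or extends a path ending in an earlier
  vertex by one of finitely many arrows.\<close>

lemma (in fin_digraph) finite_paths_of_topological_order:
  assumes order: "topological_order G vs" and all: "set vs = verts G"
  shows "finite (paths G)"
proof -
  have "i \<le> length vs \<Longrightarrow> finite {(u, p). \<exists>v\<in>set (take i vs). awalk u p v}" for i
  proof (induction i)
    case (Suc i)
    let ?X = "{(u, p). \<exists>v\<in>set (take i vs). awalk u p v}"
    have "{(u, p). \<exists>v\<in>set (take (Suc i) vs). awalk u p v} \<subseteq>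
        ?X \<union> {(vs ! i, [])} \<union> (\<lambda>((u, p), a). (u, p @ [a])) ` (?X \<times> arcs G)"
    proof (intro subsetI, rule ccontr)
      fix w assume "w \<in> {(u, p). \<exists>v\<in>set (take (Suc i) vs). awalk u p v}"
      then obtain u p v where w: "w = (u, p)" and v: "v \<in> set (take (Suc i) vs)"
        and walk: "awalk u p v"
        by auto
      assume "w \<notin> ?X \<union> {(vs ! i, [])} \<union> (\<lambda>((u, p), a). (u, p @ [a])) ` (?X \<times> arcs G)"
      then have notX: "(u, p) \<notin> ?X" and new: "(u, p) \<noteq> (vs ! i, [])"
        and old: "(u, p) \<notin> (\<lambda>((u, p), a). (u, p @ [a])) ` (?X \<times> arcs G)"
        unfolding w by (simp_all only: Un_iff de_Morgan_disj singleton_iff not_False_eq_True)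
      have notin: "(u, q) \<notin> ?X" if "p = q @ [a]" "a \<in> arcs G" for q a
      proof
        assume "(u, q) \<in> ?X"
        then have "((u, q), a) \<in> ?X \<times> arcs G"
          using that by simp
        from imageI[OF this, of "\<lambda>((u, p), a). (u, p @ [a])"] show False
          using old that by simp
      qed
      \<comment> \<open>A path to \<open>vs ! i\<close> that is not stationary would, by its last
        arrow, belong to the third set of the union.\<close>
      have "v \<in> set (take i vs)"
      proof (rule ccontr)
        assume "v \<notin> set (take i vs)"
        then have vi: "v = vs ! i"
          using v Suc.prems by (simp add: take_Suc_conv_app_nth)
        then have "p \<noteq> []"
          using new walk by (auto simp: awalk_Nil_iff)
        then obtain q a where p: "p = q @ [a]"
          by (metis rev_exhaust)
        have "awalk u q (awlast u q)" "awalk (awlast u q) [a] v"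
          using walk unfolding p awalk_append_iff by auto
        then have "awalk u q (tail G a)" "a \<in> arcs G" "head G a = vs ! i"
          using vi by (auto simp: awalk_Cons_iff awalk_Nil_iff)
        moreover from this have "tail G a \<in> set (take i vs)"
          using order Suc.prems unfolding topological_order_def by auto
        ultimately show False
          using notin[OF p] by blast
      qed
      then show False
        using walk notX by blast
    qed
    then show ?case
      using Suc by (elim finite_subset) auto
  qed simp
  from this[of "length vs"] have "finite {(u, p). \<exists>v\<in>set vs. awalk u p v}"
    by simp
  then show ?thesis
    unfolding paths_def
    by (elim finite_subset[rotated]) (auto simp: all intro: awalk_last_in_verts)
qed

text \<open>In a counterexample \<open>T\<close>, the vertices other than the sink are inner and
  receive their only arrow from among themselves. Counting arrows shows that no arrow leaves them,
  and connectedness then forces the source to be one of them.\<close>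

lemma toupie_quiver_minimal_vertex:
  assumes toupie: "toupie_quiver Q" and T: "T \<subseteq> verts Q" "T \<noteq> {}"
  shows "\<exists>v\<in>T. \<forall>a\<in>arcs Q. head Q a = v \<longrightarrow> tail Q a \<notin> T"
proof (rule ccontr)
  interpret fin_digraph Q
    using toupie unfolding toupie_quiver_def by blast
  assume "\<not> ?thesis"
  then have pred: "\<exists>a\<in>arcs Q. head Q a = v \<and> tail Q a \<in> T" if "v \<in> T" for v
    using that by blast
  \<comment> \<open>A tail of an arrow is never a sink, so discarding sinks keeps every predecessor
    found in \<open>T\<close>.\<close>
  define U where "U = {v \<in> T. \<not> is_sink Q v}"
  have tail_U: "tail Q a \<in> U" if "a \<in> arcs Q" "tail Q a \<in> T" for a
    using that unfolding U_def is_sink_def out_arcs_def by auto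
  have pred_U: "\<exists>a\<in>arcs Q. head Q a = v \<and> tail Q a \<in> U" if "v \<in> T" for v
    using pred[OF that] tail_U by blast
  have U: "U \<subseteq> verts Q" "U \<noteq> {}" "finite U"
    using T pred_U finite_subset[OF T(1)] unfolding U_def by auto
  have deg: "card (out_arcs Q v) = 1" "card (in_arcs Q v) = 1" if "v \<in> U" for v
  proof -
    have "\<not> is_source Q v" "\<not> is_sink Q v" "v \<in> verts Q"
      using that pred_U[of v] T unfolding U_def is_source_def in_arcs_def by auto
    then show "card (out_arcs Q v) = 1" "card (in_arcs Q v) = 1"
      using toupie unfolding toupie_quiver_def out_degree_def in_degree_def by auto
  qed
  \<comment> \<open>Both sets have as many arcs as \<open>U\<close> has vertices, so \<open>U\<close> is a union of connected components.\<close>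
  define E where "E = {a \<in> arcs Q. head Q a \<in> U}"
  define F where "F = {a \<in> arcs Q. tail Q a \<in> U}"
  have "E \<subseteq> F"
  proof
    \<comment> \<open>In-degree one identifies \<open>a\<close> with the arrow coming from
      \<open>U\<close>.\<close>
    fix a assume "a \<in> E"
    then have a: "a \<in> arcs Q" "head Q a \<in> U"
      unfolding E_def by auto
    then obtain b where b: "b \<in> arcs Q" "head Q b = head Q a" "tail Q b \<in> U"
      using pred_U[of "head Q a"] unfolding U_def by auto
    have "a \<in> in_arcs Q (head Q a)" "b \<in> in_arcs Q (head Q a)"
      using a b by auto
    then have "a = b"
      using deg(2)[OF a(2)] by (metis card_1_singletonE singletonD)
    then show "a \<in> F"
      using b unfolding F_def by simp
  qed
  moreover have "card E = card F"
  proof -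
    have "E = (\<Union>v\<in>U. in_arcs Q v)" "F = (\<Union>v\<in>U. out_arcs Q v)"
      unfolding E_def F_def by auto
    moreover have "card (\<Union>v\<in>U. in_arcs Q v) = (\<Sum>v\<in>U. card (in_arcs Q v))"
      by (rule card_UN_disjoint) (use U in auto)
    moreover have "card (\<Union>v\<in>U. out_arcs Q v) = (\<Sum>v\<in>U. card (out_arcs Q v))"
      by (rule card_UN_disjoint) (use U in auto)
    ultimately show ?thesis
      using deg by simp
  qed
  moreover have "finite F"
    unfolding F_def by simp
  ultimately have EF: "E = F"
    by (metis card_subset_eq)
  \<comment> \<open>By \<open>E = F\<close>, an arrow has both ends in \<open>U\<close> or neither,
    so membership is constant along undirected walks.\<close>
  have adj: "x \<in> U \<longleftrightarrow> y \<in> U" if "(x, y) \<in> parcs (mk_symmetric Q)" for x y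
  proof -
    obtain a where "a \<in> arcs Q" "x = tail Q a \<and> y = head Q a \<or> x = head Q a \<and> y = tail Q a"
      using \<open>(x, y) \<in> parcs (mk_symmetric Q)\<close> unfolding parcs_mk_symmetric by auto
    then show ?thesis
      using EF unfolding E_def F_def by auto
  qed
  obtain s where s: "is_source Q s"
    using toupie unfolding toupie_quiver_def by blast
  obtain u where u: "u \<in> U"
    using U by blast
  have "u \<rightarrow>\<^sup>*\<^bsub>mk_symmetric Q\<^esub> s"
    using toupie u U s
    unfolding toupie_quiver_def Digraph_Component.connected_def strongly_connected_def is_source_def
    by auto
  then have "s \<in> U"
    unfolding reachable_def
  proof (induction rule: rtrancl_on_induct)
    case (step x y)
    then show ?case
      using adj by (simp add: arcs_ends_conv)
  qed (rule u)
  then show False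
    using deg(2)[of s] s unfolding is_source_def by simp
qed

section \<open>Admissible ideals\<close>

text \<open>The square of the arrow ideal lies in the arrow ideal, hence in the ideal
  \<open>K\<close> of elements without stationary part. This keeps stationary paths nonzero in the
  quotient.\<close>

lemma admissible_ideal_stationary_zero:
  fixes I :: "('v \<times> 'e list \<Rightarrow> 'k::field) set"
  assumes "wf_digraph Q" and adm: "admissible_ideal Q I" and f: "f \<in> I"
  shows "f (u, []) = 0"
proof -
  let ?A = "path_algebra Q :: ('k, 'v \<times> 'e list \<Rightarrow> 'k) module"
  interpret I: ideal I ?A
    using adm unfolding admissible_ideal_def by blast
  define gens where "gens = (\<lambda>a. path_elem (tail Q a, [a]) :: 'v \<times> 'e list \<Rightarrow> 'k) ` arcs Q"
  define K where "K = {f \<in> carrier ?A. \<forall>u. f (u, []) = 0}"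
  \<comment> \<open>The record determines additive inverses only through addition, so their values
    are read off from \<open>r_neg\<close>.\<close>
  have neg: "(\<ominus>\<^bsub>?A\<^esub> f) w = - f w" if "f \<in> carrier ?A" for f w
    using fun_cong[OF I.r_neg[OF that], of w] by (simp add: path_algebra_simps add_eq_0_iff)
  \<comment> \<open>A stationary path factors only trivially, so its coefficient is
    multiplicative.\<close>
  have mult: "(f \<otimes>\<^bsub>?A\<^esub> g) (u, []) = f (u, []) * g (u, [])" for f g u
    by (simp add: path_algebra_def pre_digraph.awalk_verts.simps)
  have "ideal K ?A"
  proof (rule idealI)
    show "ring ?A" ..
    show "subgroup K (add_monoid ?A)"
    proof (rule I.add.subgroupI)
      show "K \<subseteq> carrier ?A" unfolding K_def by auto
      have "\<zero>\<^bsub>?A\<^esub> \<in> K"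
        unfolding K_def by (simp add: path_algebra_simps)
      then show "K \<noteq> {}" by auto
      show "\<And>f. f \<in> K \<Longrightarrow> \<ominus>\<^bsub>?A\<^esub> f \<in> K"
        unfolding K_def by (simp add: neg)
      show "\<And>f g. \<lbrakk>f \<in> K; g \<in> K\<rbrakk> \<Longrightarrow> f \<oplus>\<^bsub>?A\<^esub> g \<in> K"
        unfolding K_def using I.a_closed by (simp add: path_algebra_simps(2))
    qed
    fix f g assume "f \<in> K" "g \<in> carrier ?A"
    then show "f \<otimes>\<^bsub>?A\<^esub> g \<in> K" "g \<otimes>\<^bsub>?A\<^esub> f \<in> K"
      unfolding K_def by (simp_all add: mult)
  qed
  moreover have gens: "gens \<subseteq> carrier ?A"
  proof -
    interpret wf_digraph Q by fact
    have "{w. path_elem (tail Q a, [a]) w \<noteq> (0 :: 'k)} = {(tail Q a, [a])}" for a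
      by (auto simp: path_elem_def split: if_splits)
    moreover have "a \<in> arcs Q \<Longrightarrow> (tail Q a, [a]) \<in> paths Q" for a
      by (auto simp: paths_def awalk_Cons_iff awalk_Nil_iff)
    ultimately show ?thesis
      unfolding gens_def by (auto simp: path_algebra_simps(1))
  qed
  then have "gens \<subseteq> K"
    unfolding K_def by (auto simp: gens_def path_elem_def)
  ultimately have "arrow_ideal Q \<subseteq> K"
    unfolding arrow_ideal_def gens_def by (rule I.genideal_minimal)
  moreover have arrow: "ideal (arrow_ideal Q) ?A"
    unfolding arrow_ideal_def by (rule I.genideal_ideal[OF gens[unfolded gens_def]])
  \<comment> \<open>\<open>ideal_power\<close> starts from the whole ring, so the square unfolds to
    a product of three factors, the last being the arrow ideal.\<close>
  moreover have "ideal_power ?A (arrow_ideal Q) 2 \<subseteq> arrow_ideal Q"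
    using I.ideal_prod_inter[OF I.ideal_prod_is_ideal[OF I.oneideal arrow] arrow]
    by (simp add: numeral_2_eq_2)
  ultimately have "I \<subseteq> K"
    using adm unfolding admissible_ideal_def by blast
  then show ?thesis
    using f unfolding K_def by blast
qed

section \<open>The chain of ideals of a toupie algebra\<close>

theorem proposition4p10:
  fixes Q :: "('v, 'e) pre_digraph"
    and I :: "('v \<times> 'e list \<Rightarrow> 'k::field_char_0) set"
  assumes "toupie_quiver Q"
    and "admissible_ideal Q I"
  shows "quasi_hereditary (quotient_algebra (path_algebra Q) I)"
proof -
  let ?P = "path_algebra Q :: ('k, 'v \<times> 'e list \<Rightarrow> 'k) module"
    and ?q = "\<lambda>x. I +>\<^bsub>path_algebra Q\<^esub> x"
  interpret fin_digraph Q
    using assms(1) unfolding toupie_quiver_def by blast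
  have I: "ideal I ?P"
    using assms(2) unfolding admissible_ideal_def by blast
  interpret I: ideal I ?P
    by (rule I)
  obtain vs where vs: "topological_order Q vs" "set vs = verts Q"
    using ex_topological_order[OF toupie_quiver_minimal_vertex[OF assms(1)]] by blast
  interpret P: fin_dim_algebra ?P
    by (rule fin_dim_algebra_path_algebra[OF I.ring_axioms finite_paths_of_topological_order[OF vs]])
  interpret A: fin_dim_algebra "quotient_algebra ?P I"
    by (rule P.fin_dim_algebra_quotient[OF I])
  define S where "S i = set (take i vs)" for i
  define e :: "nat \<Rightarrow> 'v \<times> 'e list \<Rightarrow> 'k" where "e i = vertex_idem (S i)" for i
  have S_verts: "S i \<subseteq> verts Q" for i
    unfolding S_def vs(2)[symmetric] by (rule set_take_subset)
  have S_Suc: "S (Suc i) = insert (vs ! i) (S i)" if "i < length vs" for i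
    unfolding S_def using that by (simp add: take_Suc_conv_app_nth)
  have fresh: "vs ! i \<notin> S i" if "i < length vs" for i
    using vs(1) that unfolding S_def topological_order_def
    by (auto simp: in_set_conv_nth nth_eq_iff_index_eq)
  have closed: "tail Q a \<in> S i" if "i \<le> length vs" "a \<in> arcs Q" "head Q a \<in> S i" for a i
    using topological_order_predecessor_closed[OF vs(1)] that unfolding S_def by blast
  have into_new: "tail Q a \<in> S i" if "i < length vs" "a \<in> arcs Q" "head Q a = vs ! i" for a i
    using vs(1) that unfolding topological_order_def S_def by blast
  have e_carrier: "e i \<in> carrier ?P" for i
    unfolding e_def using S_verts by (intro vertex_idem_carrier) (simp_all add: S_def)
  have walk: "awalk u p (awlast u p)" if "x \<in> carrier ?P" "x (u, p) \<noteq> 0" for x u p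
    using that unfolding path_algebra_simps paths_def by (auto simp: subset_iff)
  \<comment> \<open>Paths ending in \<open>S i\<close> start there too, so cutting down to starts in
    \<open>S i\<close> changes nothing.\<close>
  have left: "e i \<otimes>\<^bsub>?P\<^esub> (x \<otimes>\<^bsub>?P\<^esub> e i) = x \<otimes>\<^bsub>?P\<^esub> e i"
    if "i \<le> length vs" "x \<in> carrier ?P" for i x
    unfolding e_def vertex_idem_mult mult_vertex_idem
    using awalk_start_in_predecessor_closed[OF walk[OF that(2)] _ closed[OF that(1)]]
    by (fastforce simp: fun_eq_iff)
  \<comment> \<open>Among paths ending in \<open>S (Suc i)\<close>, only the stationary one at
    \<open>vs ! i\<close> starts outside \<open>S i\<close>; its coefficient is the scalar.\<close>
  have scalar: "\<exists>b\<in>carrier ?P. x \<otimes>\<^bsub>?P\<^esub> e (Suc i) =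
      x (vs ! i, []) \<odot>\<^bsub>?P\<^esub> e (Suc i) \<oplus>\<^bsub>?P\<^esub> e i \<otimes>\<^bsub>?P\<^esub> b"
    if i: "i < length vs" and x: "x \<in> carrier ?P" for i x
  proof
    let ?v = "vs ! i"
    \<comment> \<open>The difference of both sides without the last term; multiplying by
      \<open>e i\<close> retains its part on paths starting in \<open>S i\<close>, and
      \<open>outside\<close> shows that the rest vanishes.\<close>
    let ?b = "x \<otimes>\<^bsub>?P\<^esub> e (Suc i) \<oplus>\<^bsub>?P\<^esub> (- x (?v, [])) \<odot>\<^bsub>?P\<^esub> e (Suc i)"
    show "?b \<in> carrier ?P"
      using x e_carrier by (intro I.a_closed I.m_closed P.scalar_closed)
    have outside: "(if awlast u p \<in> S (Suc i) then x (u, p) else 0)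
        = x (?v, []) * (if u \<in> S (Suc i) \<and> p = [] then 1 else 0)" if u: "u \<notin> S i" for u p
    proof (cases "p = []")
      case True
      then show ?thesis
        using u S_Suc[OF i] by auto
    next
      case False
      have "x (u, p) = 0" if last: "awlast u p \<in> S (Suc i)"
      proof (rule ccontr)
        assume "x (u, p) \<noteq> 0"
        note w = walk[OF x this]
        have cl: "\<And>a. \<lbrakk>a \<in> arcs Q; head Q a \<in> S i\<rbrakk> \<Longrightarrow> tail Q a \<in> S i"
          using closed[of i] i by simp
        have "u \<in> S i"
        \<comment> \<open>The new vertex is not in \<open>S i\<close>, but every arrow into it
          starts there.\<close>
        proof (cases "awlast u p = ?v")
          case True
          then have "awalk u p ?v"
            using w by simp
          then show ?thesis
            by (rule awalk_nonempty_start_in_predecessor_closed[OF _ False])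
               (use into_new[OF i] cl in blast)+
        next
          case False
          then have "awlast u p \<in> S i"
            using last S_Suc[OF i] by simp
          with w show ?thesis
            by (rule awalk_start_in_predecessor_closed) (use cl in blast)
        qed
        then show False
          using u by simp
      qed
      then show ?thesis
        using False by simp
    qed
    show "x \<otimes>\<^bsub>?P\<^esub> e (Suc i) = x (?v, []) \<odot>\<^bsub>?P\<^esub> e (Suc i) \<oplus>\<^bsub>?P\<^esub> e i \<otimes>\<^bsub>?P\<^esub> ?b"
    proof
      fix w :: "'v \<times> 'e list"
      obtain u p where w: "w = (u, p)" by (cases w)
      show "(x \<otimes>\<^bsub>?P\<^esub> e (Suc i)) w =
          (x (?v, []) \<odot>\<^bsub>?P\<^esub> e (Suc i) \<oplus>\<^bsub>?P\<^esub> e i \<otimes>\<^bsub>?P\<^esub> ?b) w"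
      proof (cases "u \<in> S i")
        case True
        then show ?thesis
          unfolding w e_def vertex_idem_mult mult_vertex_idem path_algebra_simps by simp
      next
        case False
        show ?thesis
          using outside[OF False, of p] False
          unfolding w e_def vertex_idem_mult mult_vertex_idem path_algebra_simps
          by (simp only: vertex_idem_def prod.case if_False add_0_right)
      qed
    qed
  qed
  note simps = quotient_algebra_simps[OF I] P.quotient_algebra_smult[OF I]
  show ?thesis
  proof (rule A.quasi_hereditary_of_idempotent_chain[of "length vs" "\<lambda>i. ?q (e i)"])
    show "?q (e i) \<in> carrier (quotient_algebra ?P I)" for i
      using e_carrier by (auto simp: simps)
    show "?q (e 0) = \<zero>\<^bsub>quotient_algebra ?P I\<^esub>"
      by (simp add: e_def S_def simps vertex_idem_empty[of Q])
    show "?q (e (length vs)) = \<one>\<^bsub>quotient_algebra ?P I\<^esub>"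
      by (simp add: e_def S_def simps vs(2) vertex_idem_verts)
  next
    fix i Y assume i: "i \<le> length vs" and "Y \<in> carrier (quotient_algebra ?P I)"
    then obtain x where x: "x \<in> carrier ?P" "Y = ?q x"
      by (auto simp: simps)
    then show "?q (e i) \<otimes>\<^bsub>quotient_algebra ?P I\<^esub> (Y \<otimes>\<^bsub>quotient_algebra ?P I\<^esub> ?q (e i)) =
        Y \<otimes>\<^bsub>quotient_algebra ?P I\<^esub> ?q (e i)"
      using e_carrier left[OF i] by (simp add: simps)
  next
    fix i Y assume i: "i < length vs" and "Y \<in> carrier (quotient_algebra ?P I)"
    then obtain x where x: "x \<in> carrier ?P" "Y = ?q x"
      by (auto simp: simps)
    obtain b where b: "b \<in> carrier ?P" "x \<otimes>\<^bsub>?P\<^esub> e (Suc i) =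
        x (vs ! i, []) \<odot>\<^bsub>?P\<^esub> e (Suc i) \<oplus>\<^bsub>?P\<^esub> e i \<otimes>\<^bsub>?P\<^esub> b"
      using scalar[OF i x(1)] by blast
    show "\<exists>c. \<exists>B\<in>carrier (quotient_algebra ?P I). Y \<otimes>\<^bsub>quotient_algebra ?P I\<^esub> ?q (e (Suc i)) =
        c \<odot>\<^bsub>quotient_algebra ?P I\<^esub> ?q (e (Suc i)) \<oplus>\<^bsub>quotient_algebra ?P I\<^esub>
        ?q (e i) \<otimes>\<^bsub>quotient_algebra ?P I\<^esub> B"
    proof (intro exI[of _ "x (vs ! i, [])"] bexI[of _ "?q b"])
      show "?q b \<in> carrier (quotient_algebra ?P I)"
        using b by (auto simp: simps)
      show "Y \<otimes>\<^bsub>quotient_algebra ?P I\<^esub> ?q (e (Suc i)) =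
          x (vs ! i, []) \<odot>\<^bsub>quotient_algebra ?P I\<^esub> ?q (e (Suc i)) \<oplus>\<^bsub>quotient_algebra ?P I\<^esub>
          ?q (e i) \<otimes>\<^bsub>quotient_algebra ?P I\<^esub> ?q b"
        using x b e_carrier by (simp add: simps P.scalar_closed)
    qed
  next
    fix i assume i: "i < length vs"
    have "e i \<otimes>\<^bsub>?P\<^esub> e (Suc i) = e i"
      unfolding e_def vertex_idem_mult S_Suc[OF i] by (auto simp: vertex_idem_def)
    then show "?q (e i) \<otimes>\<^bsub>quotient_algebra ?P I\<^esub> ?q (e (Suc i)) = ?q (e i)"
      using e_carrier by (simp add: simps)
    show "?q (e (Suc i)) \<noteq> ?q (e i)"
    proof
      assume "?q (e (Suc i)) = ?q (e i)"
      then have "e (Suc i) \<ominus>\<^bsub>?P\<^esub> e i \<in> I"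
        using e_carrier by (simp add: I.coset_eq_iff)
      \<comment> \<open>At the stationary path of \<open>vs ! i\<close>, \<open>e (Suc i)\<close> is
        1 and \<open>e i\<close> is 0, while members of \<open>I\<close> vanish there. Writing the
        difference as a sum allows comparing values directly.\<close>
      then obtain y where y: "y \<in> I" "e (Suc i) = y \<oplus>\<^bsub>?P\<^esub> e i"
        using e_carrier I.a_assoc I.l_neg
        by (intro that[of "e (Suc i) \<ominus>\<^bsub>?P\<^esub> e i"]) (simp_all add: a_minus_def)
      then have "e (Suc i) (vs ! i, []) = y (vs ! i, []) + e i (vs ! i, [])"
        by (simp add: path_algebra_simps)
      then show False
        using admissible_ideal_stationary_zero[OF wf_digraph assms(2) y(1)] fresh[OF i] S_Suc[OF i]
        by (simp add: e_def vertex_idem_def)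
    qed
  qed
qed

end
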